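(* Let $n\ge 2$ and suppose $\boldsymbol{u}=(1,2,4,\ldots,n,n+1)$ (a vector of length $n$, with spot $3$ unavailable). If $I=\{i_1,\dots,i_k\}$ with $1\le i_1<\cdots<i_k\le n$ and $c_3(n,I)$ denotes the number of outcomes of $\boldsymbol{u}$-parking functions with lucky set $I$, then $$c_3(n,I)=\sum_{j=1}^{k}c_2\big(n-1,\,I_{(i_j)}\big)+\sum_{j=1}^{k}\ \sum_{\substack{s\in[n]\setminus I\\ s>i_j}}c_1\big(n-2,\,I_{(i_j,s)}\big).$$
   Context: Notation: $[n]=\{1,\dots,n\}$, $\mathbb{N}=\{1,2,\dots\}$. For a weakly increasing vector $\boldsymbol{u}=(u_1,\dots,u_n)$ of positive integers, spot $i\in\mathbb{N}$ on a one-way street has capacity $m_i(\boldsymbol{u})$, the number of times $i$ occurs in $\boldsymbol{u}$. Cars $1,\dots,n$ enter in this order with preferences $\boldsymbol{a}=(a_1,\dots,a_n)\in\mathbb{N}^n$; car $c$ parks in the first spot $j\ge a_c$ in which fewer than $m_j(\boldsymbol{u})$ cars are already parked, and fails to park if there is none. $\boldsymbol{a}$ is a $\boldsymbol{u}$-parking function if all cars park. Its outcome is $B_1B_2\cdots B_M$ with $M=\max(\boldsymbol{u})$, where $B_i$ is the set of cars parked in spot $i$ if $m_i(\boldsymbol{u})>0$, and $B_i=\mathtt{X}$ if $m_i(\boldsymbol{u})=0$. A car is lucky if it parks in its preferred spot; the lucky set of $\boldsymbol{a}$ is the set of its lucky cars. For $I\subseteq[n]$, $c_s(n,I)$ is the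 number of distinct outcomes of $\boldsymbol{u}$-parking functions with lucky set exactly $I$, where $\boldsymbol{u}=(1,2,\dots,s-1,s+1,\dots,n+1)$ has length $n$ (there are $n$ cars, and among spots $1,\dots,n+1$ only spot $s$ is unavailable). Thus $c_1(n,I)$ corresponds to $\boldsymbol{u}=(2,3,\dots,n+1)$ and $c_2(n,I)$ to $\boldsymbol{u}=(1,3,4,\dots,n+1)$. By convention $c_1(0,\emptyset)=1$ (the empty outcome). For $j_1<\cdots<j_\ell$ in $[n]$, $$I_{(j_1,\dots,j_\ell)}=\{\,i-|\{j_1,\dots,j_\ell\}\cap[i]|\;:\; i\in I\setminus\{j_1,\dots,j_\ell\}\,\}.$$ *)

theory Defs
  imports Main
begin

text \<open>
  A vector of length \<open>n\<close> (the capacity vector \<open>u\<close>, the preferences \<open>a\<close>) is a list of length \<open>n\<close>, and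
  car \<open>c\<close> of \<open>1, \<dots>, n\<close> has preference \<open>a ! (c - 1)\<close>.
  The list \<open>ps\<close> holds the spots of the cars that have already arrived; \<open>None\<close> stands for
  a car that failed to park.
\<close>

definition capacity :: "nat list \<Rightarrow> nat \<Rightarrow> nat" where
  "capacity u j = count_list u j"

definition has_room :: "nat list \<Rightarrow> nat option list \<Rightarrow> nat \<Rightarrow> bool" where
  "has_room u ps j \<longleftrightarrow> count_list ps (Some j) < capacity u j"

definition next_spot :: "nat list \<Rightarrow> nat option list \<Rightarrow> nat \<Rightarrow> nat option" where
  "next_spot u ps x =
     (if \<exists>j\<ge>x. has_room u ps j then Some (LEAST j. x \<le> j \<and> has_room u ps j) else None)"

fun park_from :: "nat list \<Rightarrow> nat option list \<Rightarrow> nat list \<Rightarrow> nat option list" where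
  "park_from u ps [] = []"
| "park_from u ps (x # xs) =
     next_spot u ps x # park_from u (next_spot u ps x # ps) xs"

definition spot_of :: "nat list \<Rightarrow> nat list \<Rightarrow> nat \<Rightarrow> nat option" where
  "spot_of u a c = park_from u [] a ! (c - 1)"

definition parking_function :: "nat list \<Rightarrow> nat list \<Rightarrow> bool" where
  "parking_function u a \<longleftrightarrow>
     length a = length u \<and> (\<forall>x\<in>set a. 1 \<le> x) \<and>
     (\<forall>c\<in>{1..length u}. spot_of u a c \<noteq> None)"

definition lucky_set :: "nat list \<Rightarrow> nat list \<Rightarrow> nat set" where
  "lucky_set u a = {c \<in> {1..length a}. spot_of u a c = Some (a ! (c - 1))}"

text \<open>
  The block of an unavailable spot (\<open>X\<close>) is \<open>None\<close>.
  Inserting \<open>0\<close> only makes the maximum of the empty vector well-defined, so that the outcome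
  for \<open>u = []\<close> is the empty outcome.
\<close>

definition outcome :: "nat list \<Rightarrow> nat list \<Rightarrow> nat set option list" where
  "outcome u a =
     map (\<lambda>i. if capacity u i > 0 then Some {c \<in> {1..length a}. spot_of u a c = Some i} else None)
       [1..<Suc (Max (insert 0 (set u)))]"

text \<open>The vector \<open>(1, \<dots>, s - 1, s + 1, \<dots>, n + 1)\<close>, meant for \<open>1 \<le> s \<le> n + 1\<close>.\<close>

definition street_without :: "nat \<Rightarrow> nat \<Rightarrow> nat list" where
  "street_without s n = [1..<s] @ [s + 1..<n + 2]"

definition outcome_count :: "nat \<Rightarrow> nat \<Rightarrow> nat set \<Rightarrow> nat" where
  "outcome_count s n I =
     card {outcome (street_without s n) a | a.
             parking_function (street_without s n) a \<and> lucky_set (street_without s n) a = I}"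

text \<open>\<open>remove_cars I J\<close> is \<open>I\<^bsub>(j\<^sub>1, \<dots>, j\<^sub>l)\<^esub>\<close> for \<open>J = {j\<^sub>1, \<dots>, j\<^sub>l}\<close>.\<close>

definition remove_cars :: "nat set \<Rightarrow> nat set \<Rightarrow> nat set" where
  "remove_cars I J = {i - card (J \<inter> {1..i}) | i. i \<in> I - J}"

lemma outcome_count_1_0: "outcome_count 1 0 {} = 1"
proof -
  have "{outcome (street_without 1 0) a | a.
           parking_function (street_without 1 0) a \<and> lucky_set (street_without 1 0) a = {}} = {[]}"
    by (auto simp: street_without_def parking_function_def lucky_set_def outcome_def)
  then show ?thesis
    by (simp add: outcome_count_def)
qed

end

theory Submission
  imports Defs
begin

text \<open>
  On a street whose spots have capacity at most 1, the cars can be checked one at a time. Suppose it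
  is known where every car ends up. A car can always be made lucky there, by preferring its own spot.
  It can be made unlucky iff it could have been pushed there, that is, iff the spot directly before
  its own exists and was closed to it: unavailable, or taken by an earlier car. Preferring that
  spot is then enough, and every preference for a smaller spot that leads to the same place also
  finds that spot closed. The conditions for different cars do not interact, so the outcomes with lucky set
  \<open>I\<close> are exactly the placements in which every car outside \<open>I\<close> satisfies this condition
  (\<open>feasible_spots_if_parking\<close>, \<open>parking_if_feasible_spots\<close>).

  For the street without spot \<open>s\<close>, a placement is the word of the cars read along the street, and
  the condition says that every letter outside \<open>I\<close> either stands directly after the gap or exceeds
  the letter on its left (\<open>outcome_count_eq_card_arrangements\<close>). The gap cuts such a word into two
  parts without mutual constraints.

  For \<open>s = 3\<close> the word is \<open>i t X w\<close>. The first car \<open>i\<close> is lucky. If the second car \<open>t\<close> is lucky too,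
  then deleting \<open>i\<close> leaves a word \<open>t X w\<close> of the kind counted by \<open>c\<^sub>2\<close>, because a first car must be
  lucky. If \<open>t\<close> is not lucky, then \<open>t > i\<close>, and deleting both cars leaves a word \<open>X w\<close> of the kind
  counted by \<open>c\<^sub>1\<close>. This is \<open>card_arrangements_3\<close>. Only comparisons between cars matter, so the
  remaining cars can be renumbered consecutively, which is the operation \<open>remove_cars\<close>
  (\<open>outcome_count_remove_cars\<close>).
\<close>

section \<open>The parking process as a constraint on the sequence of spots\<close>

text \<open>
  The recursive process as one condition per car: \<open>take c qs\<close> are the spots of the cars before car
  \<open>Suc c\<close>, reversed because the process records the latest arrival first.
\<close>

lemma park_from_eq_iff:
  "park_from u ps xs = qs \<longleftrightarrow>
     length qs = length xs \<and>
     (\<forall>c<length xs. next_spot u (rev (take c qs) @ ps) (xs ! c) = qs ! c)"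
proof (induction xs arbitrary: ps qs)
  case Nil
  then show ?case by auto
next
  case (Cons x xs)
  show ?case
  proof (cases qs)
    case Nil
    then show ?thesis by simp
  next
    case (Cons q qs')
    show ?thesis
      unfolding Cons by (auto simp: Cons.IH All_less_Suc2)
  qed
qed

lemma next_spot_eq_Some_iff:
  "next_spot u ps x = Some y \<longleftrightarrow>
     x \<le> y \<and> has_room u ps y \<and> (\<forall>j. x \<le> j \<and> j < y \<longrightarrow> \<not> has_room u ps j)"
proof
  assume ns: "next_spot u ps x = Some y"
  then have ex: "\<exists>j. x \<le> j \<and> has_room u ps j" and y: "y = (LEAST j. x \<le> j \<and> has_room u ps j)"
    by (auto simp: next_spot_def split: if_splits)
  show "x \<le> y \<and> has_room u ps y \<and> (\<forall>j. x \<le> j \<and> j < y \<longrightarrow> \<not> has_room u ps j)"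
    using LeastI_ex[OF ex] not_less_Least[of _ "\<lambda>j. x \<le> j \<and> has_room u ps j"] y by blast
next
  assume *: "x \<le> y \<and> has_room u ps y \<and> (\<forall>j. x \<le> j \<and> j < y \<longrightarrow> \<not> has_room u ps j)"
  then have "(LEAST j. x \<le> j \<and> has_room u ps j) = y"
    by (intro Least_equality) (auto simp: not_less[symmetric])
  with * show "next_spot u ps x = Some y"
    by (auto simp: next_spot_def)
qed

lemma capacity_distinct: "distinct u \<Longrightarrow> capacity u j = (if j \<in> set u then 1 else 0)"
  unfolding capacity_def by (induction u) auto

lemma has_room_distinct:
  "distinct u \<Longrightarrow> has_room u ps j \<longleftrightarrow> j \<in> set u \<and> Some j \<notin> set ps"
  by (simp add: has_room_def capacity_distinct count_list_0_iff)

lemma park_from_eq_map_Some_iff: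
  assumes "distinct u"
  shows "park_from u [] a = map Some \<sigma> \<longleftrightarrow>
     length \<sigma> = length a \<and>
     (\<forall>c<length a. a ! c \<le> \<sigma> ! c \<and> \<sigma> ! c \<in> set u \<and> \<sigma> ! c \<notin> set (take c \<sigma>) \<and>
        (\<forall>j. a ! c \<le> j \<and> j < \<sigma> ! c \<longrightarrow> j \<notin> set u \<or> j \<in> set (take c \<sigma>)))"
proof -
  have step: "next_spot u (rev (take c (map Some \<sigma>)) @ []) x = Some y \<longleftrightarrow>
      x \<le> y \<and> y \<in> set u \<and> y \<notin> set (take c \<sigma>) \<and>
      (\<forall>j. x \<le> j \<and> j < y \<longrightarrow> j \<notin> set u \<or> j \<in> set (take c \<sigma>))" for c x y
    by (auto simp: next_spot_eq_Some_iff has_room_distinct[OF assms] take_map)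
  have "park_from u [] a = map Some \<sigma> \<longleftrightarrow> length \<sigma> = length a \<and>
      (\<forall>c<length a. next_spot u (rev (take c (map Some \<sigma>)) @ []) (a ! c) = Some (\<sigma> ! c))"
    unfolding park_from_eq_iff by (rule conj_cong) (auto simp del: append_Nil2)
  then show ?thesis
    by (simp only: step)
qed

lemma distinct_if_nth_notin_take:
  assumes "\<And>c. c < length xs \<Longrightarrow> xs ! c \<notin> set (take c xs)"
  shows "distinct xs"
proof -
  have "xs ! i \<noteq> xs ! j" if "i < j" "j < length xs" for i j
    using assms[of j] that by (auto simp: in_set_conv_nth)
  then show ?thesis
    by (metis distinct_conv_nth nat_neq_iff)
qed

lemma distinct_nth_notin_take:
  assumes "distinct xs" "c < length xs"
  shows "xs ! c \<notin> set (take c xs)"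
  using assms by (auto simp: in_set_conv_nth distinct_conv_nth)

text \<open>
  Here \<open>\<sigma> ! c\<close> is the spot of car \<open>Suc c\<close>. The last conjunct is the condition for a car to be
  unlucky: it has a spot before its own to prefer, and finds that spot closed.
\<close>

definition feasible_spots :: "nat list \<Rightarrow> nat set \<Rightarrow> nat list \<Rightarrow> bool" where
  "feasible_spots u I \<sigma> \<longleftrightarrow>
     distinct \<sigma> \<and> set \<sigma> = set u \<and>
     (\<forall>c<length u. Suc c \<notin> I \<longrightarrow>
        2 \<le> \<sigma> ! c \<and> (\<sigma> ! c - 1 \<notin> set u \<or> \<sigma> ! c - 1 \<in> set (take c \<sigma>)))"

lemma feasible_spots_length:
  "distinct u \<Longrightarrow> feasible_spots u I \<sigma> \<Longrightarrow> length \<sigma> = length u"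
  by (metis distinct_card feasible_spots_def)

text \<open>
  An unlucky car drives past every spot from its preference up to its own, hence also past the
  spot directly before its own.
\<close>

lemma feasible_spots_if_parking:
  assumes u: "distinct u" and pf: "parking_function u a" and I: "lucky_set u a = I"
  obtains \<sigma> where "park_from u [] a = map Some \<sigma>" "feasible_spots u I \<sigma>"
proof -
  have len: "length a = length u" and pos: "\<And>c. c < length u \<Longrightarrow> 1 \<le> a ! c"
    and parked: "\<And>c. c \<in> {1..length u} \<Longrightarrow> spot_of u a c \<noteq> None"
    using pf by (auto simp: parking_function_def)
  have lenP: "length (park_from u [] a) = length u"
    using park_from_eq_iff[THEN iffD1, OF refl, of u "[]" a] len by simp
  have nN: "park_from u [] a ! c \<noteq> None" if "c < length u" for c
    using parked[of "Suc c"] that by (simp add: spot_of_def)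
  define \<sigma> where "\<sigma> = map the (park_from u [] a)"
  have P: "park_from u [] a = map Some \<sigma>"
    unfolding \<sigma>_def using nN lenP by (intro nth_equalityI) auto
  have len\<sigma>: "length \<sigma> = length u"
    using lenP P by simp
  have steps: "a ! c \<le> \<sigma> ! c" "\<sigma> ! c \<in> set u" "\<sigma> ! c \<notin> set (take c \<sigma>)"
     "\<And>j. a ! c \<le> j \<Longrightarrow> j < \<sigma> ! c \<Longrightarrow> j \<notin> set u \<or> j \<in> set (take c \<sigma>)" if "c < length u" for c
    using P that len unfolding park_from_eq_map_Some_iff[OF u] by auto
  have dist: "distinct \<sigma>"
    using steps(3) len\<sigma> by (intro distinct_if_nth_notin_take) auto
  have "set \<sigma> \<subseteq> set u"
    using steps(2) len\<sigma> by (auto simp: in_set_conv_nth)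
  then have set\<sigma>: "set \<sigma> = set u"
    using dist u len\<sigma> by (intro card_subset_eq) (auto simp: distinct_card)
  have "2 \<le> \<sigma> ! c \<and> (\<sigma> ! c - 1 \<notin> set u \<or> \<sigma> ! c - 1 \<in> set (take c \<sigma>))"
    if c: "c < length u" "Suc c \<notin> I" for c
  proof -
    have "\<sigma> ! c \<noteq> a ! c"
      using c I len len\<sigma> by (auto simp: lucky_set_def spot_of_def P)
    with steps(1)[of c] pos[of c] c have "1 \<le> a ! c" "a ! c \<le> \<sigma> ! c - 1" "\<sigma> ! c - 1 < \<sigma> ! c"
      by linarith+
    then show ?thesis
      using steps(4)[of c "\<sigma> ! c - 1"] c by linarith
  qed
  with dist set\<sigma> have "feasible_spots u I \<sigma>"
    by (simp add: feasible_spots_def)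
  with P show ?thesis ..
qed

text \<open>
  The witness lets the cars in \<open>I\<close> prefer their own spot and the others the spot before it. The
  latter is closed when they arrive, and then their own spot is the next one that they try.
\<close>

lemma parking_if_feasible_spots:
  assumes u: "distinct u" "0 \<notin> set u" and \<sigma>: "feasible_spots u I \<sigma>" and I: "I \<subseteq> {1..length u}"
  obtains a where "parking_function u a" "lucky_set u a = I" "park_from u [] a = map Some \<sigma>"
proof -
  define a where "a = map (\<lambda>c. if Suc c \<in> I then \<sigma> ! c else \<sigma> ! c - 1) [0..<length u]"
  have len\<sigma>: "length \<sigma> = length u"
    using feasible_spots_length u(1) \<sigma> by blast
  have dist: "distinct \<sigma>" and set\<sigma>: "set \<sigma> = set u"
    and unlucky: "\<And>c. c < length u \<Longrightarrow> Suc c \<notin> I \<Longrightarrow>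
        2 \<le> \<sigma> ! c \<and> (\<sigma> ! c - 1 \<notin> set u \<or> \<sigma> ! c - 1 \<in> set (take c \<sigma>))"
    using \<sigma> by (auto simp: feasible_spots_def)
  have mem: "\<sigma> ! c \<in> set u" if "c < length u" for c
    using that len\<sigma> set\<sigma> nth_mem by metis
  have nth_a: "a ! c = (if Suc c \<in> I then \<sigma> ! c else \<sigma> ! c - 1)" if "c < length u" for c
    using that by (simp add: a_def)
  have len_a: "length a = length u"
    by (simp add: a_def)
  have P: "park_from u [] a = map Some \<sigma>"
    unfolding park_from_eq_map_Some_iff[OF u(1)]
  proof (intro conjI allI impI)
    fix c j assume c: "c < length a" and j: "a ! c \<le> j \<and> j < \<sigma> ! c"
    then have "Suc c \<notin> I" "j = \<sigma> ! c - 1"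
      using nth_a[of c] len_a by (auto split: if_splits)
    then show "j \<notin> set u \<or> j \<in> set (take c \<sigma>)"
      using unlucky[of c] c len_a by auto
  qed (use len_a len\<sigma> nth_a mem distinct_nth_notin_take[OF dist] in auto)
  have pos: "1 \<le> a ! c" if "c < length u" for c
  proof (cases "Suc c \<in> I")
    case True
    have "\<sigma> ! c \<noteq> 0" using mem[OF that] u(2) by metis
    with True that show ?thesis by (simp add: nth_a)
  next
    case False
    with that unlucky[of c] have "2 \<le> \<sigma> ! c" "a ! c = \<sigma> ! c - 1"
      by (auto simp: nth_a)
    then show ?thesis by linarith
  qed
  have "parking_function u a"
    using pos len_a len\<sigma> P by (auto simp: parking_function_def spot_of_def in_set_conv_nth)
  moreover have "lucky_set u a = I"
  proof -
    have "Suc c \<in> lucky_set u a \<longleftrightarrow> Suc c \<in> I" if "c < length u" for c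
      using that unlucky[of c] len_a len\<sigma> nth_a[of c] by (auto simp: lucky_set_def spot_of_def P)
    then have "c \<in> lucky_set u a \<longleftrightarrow> c \<in> I" if "c \<in> {1..length u}" for c
      using that by (cases c) auto
    moreover have "lucky_set u a \<subseteq> {1..length u}"
      by (auto simp: lucky_set_def len_a)
    ultimately show ?thesis
      using I by blast
  qed
  ultimately show ?thesis
    using P that by blast
qed

definition blocks :: "nat list \<Rightarrow> nat list \<Rightarrow> nat set option list" where
  "blocks u \<sigma> =
     map (\<lambda>i. if i \<in> set u then Some {c \<in> {1..length u}. \<sigma> ! (c - 1) = i} else None)
       [1..<Suc (Max (insert 0 (set u)))]"

lemma outcome_eq_blocks:
  assumes "distinct u" "length a = length u" "park_from u [] a = map Some \<sigma>"
  shows "outcome u a = blocks u \<sigma>"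
proof -
  have "length \<sigma> = length u"
    using park_from_eq_iff[THEN iffD1, OF assms(3)] assms(2) by simp
  then have "{c \<in> {1..length u}. spot_of u a c = Some i} = {c \<in> {1..length u}. \<sigma> ! (c - 1) = i}" for i
    by (auto simp: spot_of_def assms(3))
  then show ?thesis
    by (simp add: outcome_def blocks_def capacity_distinct assms)
qed

text \<open>Each car stands in exactly one block, so the blocks determine the spots of all cars.\<close>

lemma inj_on_blocks:
  assumes u: "distinct u" "0 \<notin> set u"
  shows "inj_on (blocks u) {\<sigma>. feasible_spots u I \<sigma>}"
proof (rule inj_onI)
  fix \<sigma> \<tau> assume "\<sigma> \<in> {\<sigma>. feasible_spots u I \<sigma>}" "\<tau> \<in> {\<sigma>. feasible_spots u I \<sigma>}"
    and eq: "blocks u \<sigma> = blocks u \<tau>"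
  then have f: "feasible_spots u I \<sigma>" "feasible_spots u I \<tau>" by auto
  then have len: "length \<sigma> = length u" "length \<tau> = length u"
    using feasible_spots_length u(1) by blast+
  show "\<sigma> = \<tau>"
  proof (rule nth_equalityI)
    fix c assume c: "c < length \<sigma>"
    define i where "i = \<sigma> ! c"
    have i: "i \<in> set u"
      using c f(1) by (auto simp: i_def feasible_spots_def)
    then have "i \<noteq> 0" using u(2) by metis
    moreover have "i \<le> Max (insert 0 (set u))"
      using i by simp
    ultimately have "i \<in> set [1..<Suc (Max (insert 0 (set u)))]"
      by auto
    then have "{c \<in> {1..length u}. \<sigma> ! (c - 1) = i} = {c \<in> {1..length u}. \<tau> ! (c - 1) = i}"
      using bspec[OF eq[unfolded blocks_def map_eq_conv], of i] i by (simp del: set_upt)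
    moreover have "Suc c \<in> {c \<in> {1..length u}. \<sigma> ! (c - 1) = i}"
      using c len by (simp add: i_def)
    ultimately have "\<tau> ! c = i" by auto
    then show "\<sigma> ! c = \<tau> ! c" by (simp add: i_def)
  qed (simp add: len)
qed

lemma card_outcomes:
  assumes u: "distinct u" "0 \<notin> set u" and I: "I \<subseteq> {1..length u}"
  shows "card {outcome u a | a. parking_function u a \<and> lucky_set u a = I}
           = card {\<sigma>. feasible_spots u I \<sigma>}"
proof -
  have "{outcome u a | a. parking_function u a \<and> lucky_set u a = I}
          = blocks u ` {\<sigma>. feasible_spots u I \<sigma>}"
  proof (intro subset_antisym subsetI)
    fix x assume "x \<in> {outcome u a | a. parking_function u a \<and> lucky_set u a = I}"
    then obtain a where a: "x = outcome u a" "parking_function u a" "lucky_set u a = I"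
      by blast
    obtain \<sigma> where "park_from u [] a = map Some \<sigma>" "feasible_spots u I \<sigma>"
      using feasible_spots_if_parking[OF u(1) a(2,3)] .
    then show "x \<in> blocks u ` {\<sigma>. feasible_spots u I \<sigma>}"
      using outcome_eq_blocks[OF u(1)] a by (auto simp: parking_function_def)
  next
    fix x assume "x \<in> blocks u ` {\<sigma>. feasible_spots u I \<sigma>}"
    then obtain \<sigma> where \<sigma>: "x = blocks u \<sigma>" "feasible_spots u I \<sigma>"
      by blast
    obtain a where a: "parking_function u a" "lucky_set u a = I" "park_from u [] a = map Some \<sigma>"
      using parking_if_feasible_spots[OF u \<sigma>(2) I] .
    then have "x = outcome u a"
      using outcome_eq_blocks[OF u(1)] \<sigma>(1) by (simp add: parking_function_def)
    with a show "x \<in> {outcome u a | a. parking_function u a \<and> lucky_set u a = I}"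
      by blast
  qed
  then show ?thesis
    by (simp add: card_image inj_on_blocks[OF u])
qed

section \<open>Outcomes as words of cars along the street\<close>

text \<open>
  The word \<open>w\<close> lists the cars along the available spots of the street without spot \<open>s\<close>. The letters
  at positions \<open>0, \<dots>, s - 2\<close> are in the spots \<open>1, \<dots>, s - 1\<close>, so \<open>Suc p = s\<close> says that position \<open>p\<close>
  comes directly after the gap. If the gap is at the end of the street, no position does.
\<close>

definition arrangement :: "nat \<Rightarrow> nat set \<Rightarrow> nat list \<Rightarrow> bool" where
  "arrangement s I w \<longleftrightarrow>
     (\<forall>p<length w. w ! p \<notin> I \<longrightarrow> Suc p = s \<or> (0 < p \<and> w ! (p - 1) < w ! p))"

definition arrangements :: "nat \<Rightarrow> nat set \<Rightarrow> nat set \<Rightarrow> nat list set" where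
  "arrangements s C I = {w. distinct w \<and> set w = C \<and> arrangement s I w}"

definition index_of :: "'a list \<Rightarrow> 'a \<Rightarrow> nat" where
  "index_of xs x = (LEAST p. xs ! p = x)"

lemma index_of_nth:
  assumes "distinct xs" "p < length xs"
  shows "index_of xs (xs ! p) = p"
  unfolding index_of_def
proof (rule Least_equality)
  fix q assume "xs ! q = xs ! p"
  then show "p \<le> q"
    using assms nth_eq_iff_index_eq[of xs q p] by (cases "q < length xs") auto
qed simp

lemma index_of_mem:
  assumes "distinct xs" "x \<in> set xs"
  shows "index_of xs x < length xs" "xs ! index_of xs x = x"
  using assms by (auto simp: in_set_conv_nth index_of_nth)

lemma street_without_conv_map:
  assumes "1 \<le> s" "s \<le> Suc n"
  shows "street_without s n = map (\<lambda>p. if Suc p < s then Suc p else p + 2) [0..<n]"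
  using assms by (intro nth_equalityI) (auto simp: street_without_def nth_append)

lemma
  assumes "1 \<le> s" "s \<le> Suc n"
  shows length_street_without: "length (street_without s n) = n"
    and distinct_street_without: "distinct (street_without s n)"
    and set_street_without: "set (street_without s n) = {1..Suc n} - {s}"
  using assms by (auto simp: street_without_def)

lemma nth_street_without:
  assumes "1 \<le> s" "s \<le> Suc n" "p < n"
  shows "street_without s n ! p = (if Suc p < s then Suc p else p + 2)"
  using assms by (simp add: street_without_conv_map)

text \<open>
  A placement is a bijection between cars and spots. The list \<open>\<sigma>\<close> of feasible placements is indexed
  by the cars and the word of an arrangement by the spots \<open>u\<close>; these functions invert one
  into the other.
\<close>

definition word_of :: "nat list \<Rightarrow> nat list \<Rightarrow> nat list" where
  "word_of u \<sigma> = map (\<lambda>j. Suc (index_of \<sigma> j)) u"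

definition spots_of :: "nat list \<Rightarrow> nat list \<Rightarrow> nat list" where
  "spots_of u w = map (\<lambda>c. u ! index_of w (Suc c)) [0..<length u]"

lemma word_of_properties:
  assumes u: "distinct u" and \<sigma>: "distinct \<sigma>" "set \<sigma> = set u"
  shows "distinct (word_of u \<sigma>)" "set (word_of u \<sigma>) = {1..length u}"
    "spots_of u (word_of u \<sigma>) = \<sigma>"
proof -
  have len: "length \<sigma> = length u"
    using assms by (metis distinct_card)
  have "inj_on (index_of \<sigma>) (set u)"
    using index_of_mem(2)[OF \<sigma>(1)] \<sigma>(2) by (metis inj_onI)
  then show dist: "distinct (word_of u \<sigma>)"
    using u by (auto simp: word_of_def distinct_map inj_on_def)
  have "set (word_of u \<sigma>) \<subseteq> {1..length u}"
    using index_of_mem(1)[OF \<sigma>(1)] \<sigma>(2) len by (auto simp: word_of_def Suc_le_eq)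
  then show "set (word_of u \<sigma>) = {1..length u}"
    using distinct_card[OF dist] by (intro card_subset_eq) (auto simp: word_of_def)
  show "spots_of u (word_of u \<sigma>) = \<sigma>"
  proof (rule nth_equalityI)
    fix c assume c: "c < length (spots_of u (word_of u \<sigma>))"
    then have c': "c < length \<sigma>"
      by (simp add: spots_of_def len)
    then have "\<sigma> ! c \<in> set u"
      using \<sigma>(2) nth_mem by metis
    then obtain p where p: "p < length u" "u ! p = \<sigma> ! c"
      by (auto simp: in_set_conv_nth)
    then have "word_of u \<sigma> ! p = Suc c"
      using index_of_nth[OF \<sigma>(1) c'] by (simp add: word_of_def)
    then have "index_of (word_of u \<sigma>) (Suc c) = p"
      using index_of_nth[OF dist, of p] p by (simp add: word_of_def)
    with p c' show "spots_of u (word_of u \<sigma>) ! c = \<sigma> ! c"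
      by (simp add: spots_of_def len)
  qed (simp add: spots_of_def len)
qed

lemma spots_of_properties:
  assumes u: "distinct u" and w: "distinct w" "set w = {1..length u}"
  shows "distinct (spots_of u w)" "set (spots_of u w) = set u"
    "word_of u (spots_of u w) = w"
proof -
  have len: "length w = length u"
    using w distinct_card[OF w(1)] by simp
  have ind: "index_of w (Suc c) < length u" "w ! index_of w (Suc c) = Suc c" if "c < length u" for c
    using index_of_mem[OF w(1), of "Suc c"] w(2) len that by auto
  have "inj_on (\<lambda>c. u ! index_of w (Suc c)) {0..<length u}"
    by (rule inj_onI)
      (metis atLeastLessThan_iff ind nat.inject nth_eq_iff_index_eq u)
  then show dist: "distinct (spots_of u w)"
    by (simp add: spots_of_def distinct_map)
  have "set (spots_of u w) \<subseteq> set u"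
    using ind by (auto simp: spots_of_def)
  then show "set (spots_of u w) = set u"
    using distinct_card[OF dist] distinct_card[OF u]
    by (intro card_subset_eq) (auto simp: spots_of_def)
  show "word_of u (spots_of u w) = w"
  proof (rule nth_equalityI)
    fix p assume "p < length (word_of u (spots_of u w))"
    then have p: "p < length u"
      by (simp add: word_of_def)
    then have wp: "w ! p \<in> {1..length u}"
      using len w(2) nth_mem by metis
    then have "spots_of u w ! (w ! p - 1) = u ! p"
      using index_of_nth[OF w(1), of p] p len by (auto simp: spots_of_def)
    then have "index_of (spots_of u w) (u ! p) = w ! p - 1"
      using index_of_nth[OF dist, of "w ! p - 1"] wp by (auto simp: spots_of_def)
    with p wp show "word_of u (spots_of u w) ! p = w ! p"
      by (simp add: word_of_def)
  qed (simp add: word_of_def len)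
qed

lemma mem_take_iff_index_of:
  assumes "distinct xs" "x \<in> set xs" "c \<le> length xs"
  shows "x \<in> set (take c xs) \<longleftrightarrow> index_of xs x < c"
proof
  assume "x \<in> set (take c xs)"
  then show "index_of xs x < c"
    using assms index_of_nth[OF assms(1)] by (auto simp: in_set_conv_nth)
next
  assume "index_of xs x < c"
  then show "x \<in> set (take c xs)"
    using index_of_mem[OF assms(1,2)] assms(3) by (force simp: in_set_conv_nth)
qed

text \<open>
  The spot before the one at position \<open>p\<close> is missing if \<open>p = 0\<close> and the gap is not in front of it, is
  the unavailable spot if \<open>Suc p = s\<close>, and is the one at position \<open>p - 1\<close> otherwise; in the last
  case, being taken already means holding a car with a smaller number.
\<close>

lemma feasible_spots_iff_arrangement:
  assumes s: "1 \<le> s" "s \<le> Suc n" and u: "u = street_without s n"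
    and \<sigma>: "distinct \<sigma>" "set \<sigma> = set u"
  shows "feasible_spots u I \<sigma> \<longleftrightarrow> arrangement s I (word_of u \<sigma>)"
proof -
  note street = length_street_without[OF s] distinct_street_without[OF s] set_street_without[OF s]
  have len: "length \<sigma> = n" "length u = n"
    using \<sigma> street distinct_card u by metis+
  let ?ok = "\<lambda>c. 2 \<le> \<sigma> ! c \<and> (\<sigma> ! c - 1 \<notin> set u \<or> \<sigma> ! c - 1 \<in> set (take c \<sigma>))"
  let ?w = "word_of u \<sigma>"
  \<comment> \<open>car \<open>Suc (index_of \<sigma> (u ! p))\<close> is the one in spot \<open>u ! p\<close>, the letter at position \<open>p\<close>\<close>
  have ok: "?ok (index_of \<sigma> (u ! p)) \<longleftrightarrow> Suc p = s \<or> (0 < p \<and> ?w ! (p - 1) < ?w ! p)"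
    if p: "p < n" for p
  proof -
    have nth: "u ! q = (if Suc q < s then Suc q else q + 2)" if "q < n" for q
      using nth_street_without[OF s that] u by simp
    have up: "u ! p \<in> set \<sigma>"
      using \<sigma>(2) p len by simp
    have ind: "index_of \<sigma> (u ! p) < n" "\<sigma> ! index_of \<sigma> (u ! p) = u ! p"
      using index_of_mem[OF \<sigma>(1) up] len by auto
    consider "Suc p = s" | "Suc p \<noteq> s" "p = 0" | "Suc p \<noteq> s" "0 < p" by blast
    then show ?thesis
    proof cases
      case 1
      then have "u ! p = Suc s" using nth[OF p] by simp
      with 1 ind show ?thesis using street(3) u s by simp
    next
      case 2
      then show ?thesis using ind nth[OF p] s by simp
    next
      case 3
      then have prev: "u ! p - 1 = u ! (p - 1)" "2 \<le> u ! p"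
        using nth[OF p] nth[of "p - 1"] p by auto
      have mem: "u ! (p - 1) \<in> set u"
        using p len by simp
      have "?ok (index_of \<sigma> (u ! p)) \<longleftrightarrow> u ! (p - 1) \<in> set (take (index_of \<sigma> (u ! p)) \<sigma>)"
        using ind prev mem by simp
      also have "\<dots> \<longleftrightarrow> index_of \<sigma> (u ! (p - 1)) < index_of \<sigma> (u ! p)"
        using mem_take_iff_index_of[OF \<sigma>(1)] mem \<sigma>(2) ind(1) len by simp
      finally show ?thesis
        using 3 p len by (simp add: word_of_def)
    qed
  qed
  have "feasible_spots u I \<sigma> \<longleftrightarrow> (\<forall>c\<in>{0..<n}. Suc c \<notin> I \<longrightarrow> ?ok c)"
    using \<sigma> len by (auto simp: feasible_spots_def)
  also have "{0..<n} = (\<lambda>p. index_of \<sigma> (u ! p)) ` {0..<n}"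
  proof -
    have "u ! p \<in> set \<sigma>" if "p < n" for p
      using \<sigma>(2) that len by simp
    moreover have "\<exists>p<n. c = index_of \<sigma> (u ! p)" if "c < n" for c
      using index_of_nth[OF \<sigma>(1)] \<sigma>(2) that len by (metis in_set_conv_nth)
    ultimately show ?thesis
      using index_of_mem(1)[OF \<sigma>(1)] len by fastforce
  qed
  also have "(\<forall>c\<in>\<dots>. Suc c \<notin> I \<longrightarrow> ?ok c) \<longleftrightarrow> arrangement s I ?w"
    using ok len by (auto simp: arrangement_def word_of_def)
  finally show ?thesis .
qed

lemma outcome_count_eq_card_arrangements:
  assumes s: "1 \<le> s" "s \<le> Suc n" and I: "I \<subseteq> {1..n}"
  shows "outcome_count s n I = card (arrangements s {1..n} I)"
proof -
  define u where "u = street_without s n"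
  have u: "length u = n" "distinct u" "0 \<notin> set u"
    using length_street_without[OF s] distinct_street_without[OF s] set_street_without[OF s]
    by (auto simp: u_def)
  note iff = feasible_spots_iff_arrangement[OF s u_def]
  have "outcome_count s n I = card {\<sigma>. feasible_spots u I \<sigma>}"
    using card_outcomes[OF u(2,3)] I u(1) by (simp add: outcome_count_def u_def)
  also have "bij_betw (word_of u) {\<sigma>. feasible_spots u I \<sigma>} (arrangements s {1..n} I)"
  proof (rule bij_betw_byWitness[where f' = "spots_of u"])
    have feas: "distinct \<sigma>" "set \<sigma> = set u" if "feasible_spots u I \<sigma>" for \<sigma>
      using that by (auto simp: feasible_spots_def)
    show "\<forall>\<sigma>\<in>{\<sigma>. feasible_spots u I \<sigma>}. spots_of u (word_of u \<sigma>) = \<sigma>"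
      using word_of_properties(3)[OF u(2)] feas by auto
    show "\<forall>w\<in>arrangements s {1..n} I. word_of u (spots_of u w) = w"
      using spots_of_properties(3)[OF u(2)] u(1) by (auto simp: arrangements_def)
    show "word_of u ` {\<sigma>. feasible_spots u I \<sigma>} \<subseteq> arrangements s {1..n} I"
    proof (rule image_subsetI)
      fix \<sigma> assume "\<sigma> \<in> {\<sigma>. feasible_spots u I \<sigma>}"
      then have \<sigma>: "feasible_spots u I \<sigma>" by simp
      with iff[OF feas[OF \<sigma>]] have "arrangement s I (word_of u \<sigma>)" by simp
      with word_of_properties(1,2)[OF u(2) feas[OF \<sigma>]] u(1)
      show "word_of u \<sigma> \<in> arrangements s {1..n} I"
        by (simp add: arrangements_def)
    qed
    show "spots_of u ` arrangements s {1..n} I \<subseteq> {\<sigma>. feasible_spots u I \<sigma>}"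
    proof (rule image_subsetI)
      fix w assume "w \<in> arrangements s {1..n} I"
      then have w: "distinct w" "set w = {1..length u}" "arrangement s I w"
        using u(1) by (auto simp: arrangements_def)
      note props = spots_of_properties[OF u(2) w(1,2)]
      show "spots_of u w \<in> {\<sigma>. feasible_spots u I \<sigma>}"
        using iff[OF props(1,2), of I] props(3) w(3) by simp
    qed
  qed
  then have "card {\<sigma>. feasible_spots u I \<sigma>} = card (arrangements s {1..n} I)"
    by (rule bij_betw_same_card)
  finally show ?thesis .
qed

section \<open>Relabelling the remaining cars\<close>

text \<open>
  Arrangements only compare letters and test membership in \<open>I\<close>, so any order-preserving
  relabelling of the cars respects them.
\<close>

lemma card_arrangements_relabel:
  assumes f: "strict_mono_on C f"
  shows "card (arrangements s (f ` C) (f ` (I \<inter> C))) = card (arrangements s C I)"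
proof -
  have inj: "inj_on f C"
    using f by (rule strict_mono_on_imp_inj_on)
  have less: "f x < f y \<longleftrightarrow> x < y" if "x \<in> C" "y \<in> C" for x y
    using strict_mono_on_less[OF f that] .
  have iff: "arrangement s (f ` (I \<inter> C)) (map f w) \<longleftrightarrow> arrangement s I w" if "set w = C" for w
  proof -
    have "w ! p \<in> C" if "p < length w" for p
      using that \<open>set w = C\<close> by auto
    moreover have "f x \<in> f ` (I \<inter> C) \<longleftrightarrow> x \<in> I" if "x \<in> C" for x
      using that inj by (auto simp: inj_on_def)
    ultimately show ?thesis
      using less by (auto simp: arrangement_def)
  qed
  have "bij_betw (map f) (arrangements s C I) (arrangements s (f ` C) (f ` (I \<inter> C)))"
    unfolding bij_betw_def
  proof (intro conjI subset_antisym subsetI)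
    show "inj_on (map f) (arrangements s C I)"
    proof (rule inj_onI)
      fix v w assume "v \<in> arrangements s C I" "w \<in> arrangements s C I" "map f v = map f w"
      then show "v = w"
        using inj by (intro map_inj_on[of f v w]) (auto simp: arrangements_def)
    qed
    fix w assume "w \<in> map f ` arrangements s C I"
    then show "w \<in> arrangements s (f ` C) (f ` (I \<inter> C))"
      using inj iff by (auto simp: arrangements_def distinct_map)
  next
    fix v assume v: "v \<in> arrangements s (f ` C) (f ` (I \<inter> C))"
    then have "v \<in> map f ` lists C"
      by (auto simp: arrangements_def simp flip: lists_image)
    then obtain w where w: "v = map f w" "set w \<subseteq> C" by auto
    then have "f ` set w = f ` C"
      using v by (simp add: arrangements_def)
    then have "set w = C"
      using inj w(2) by (simp add: inj_on_image_eq_iff)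
    with w v iff show "v \<in> map f ` arrangements s C I"
      by (auto simp: arrangements_def distinct_map)
  qed
  then show ?thesis
    by (metis bij_betw_same_card)
qed

text \<open>
  The renumbering of the cars that remain when those in \<open>J\<close> leave. Between two remaining cars
  \<open>a < b\<close> at most \<open>b - a - 1\<close> cars leave, so subtracting the number of leaving cars up to each
  keeps them in strict order; the image is then found by counting.
\<close>

lemma
  assumes J: "J \<subseteq> {1..n}"
  defines "f \<equiv> \<lambda>i. i - card (J \<inter> {1..i})"
  shows strict_mono_on_closing_gaps: "strict_mono_on ({1..n} - J) f"
    and image_closing_gaps: "f ` ({1..n} - J) = {1..n - card J}"
proof -
  have below: "card (J \<inter> {1..i}) < i" if "i \<in> {1..n} - J" for i
  proof -
    have "J \<inter> {1..i} \<subseteq> {1..<i}" using that by (auto simp: order_le_less)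
    then have "card (J \<inter> {1..i}) \<le> card {1..<i}" by (intro card_mono) auto
    with that show ?thesis by auto
  qed
  have gap: "card (J \<inter> {1..b}) \<le> card (J \<inter> {1..a}) + card (J \<inter> {a<..b})" for a b
  proof -
    have "J \<inter> {1..b} \<subseteq> (J \<inter> {1..a}) \<union> (J \<inter> {a<..b})" by auto
    then have "card (J \<inter> {1..b}) \<le> card ((J \<inter> {1..a}) \<union> (J \<inter> {a<..b}))"
      by (intro card_mono) auto
    also have "\<dots> \<le> card (J \<inter> {1..a}) + card (J \<inter> {a<..b})"
      by (rule card_Un_le)
    finally show ?thesis .
  qed
  show mono: "strict_mono_on ({1..n} - J) f"
  proof (rule strict_mono_onI)
    fix a b assume ab: "a \<in> {1..n} - J" "b \<in> {1..n} - J" "a < b"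
    then have "J \<inter> {a<..b} \<subseteq> {a<..<b}" by (auto simp: order_le_less)
    then have "card (J \<inter> {a<..b}) \<le> card {a<..<b}" by (intro card_mono) auto
    with gap[of b a] below[OF ab(1)] below[OF ab(2)] ab(3) show "f a < f b"
      unfolding f_def card_greaterThanLessThan by linarith
  qed
  have "f ` ({1..n} - J) \<subseteq> {1..n - card J}"
  proof
    fix y assume "y \<in> f ` ({1..n} - J)"
    then obtain i where i: "i \<in> {1..n} - J" "y = i - card (J \<inter> {1..i})"
      by (auto simp: f_def)
    have "card (J \<inter> {i<..n}) \<le> n - i"
      using card_mono[of "{i<..n}" "J \<inter> {i<..n}"] by simp
    moreover have "card (J \<inter> {1..n}) = card J"
      using J by (simp add: Int_absorb2)
    moreover have "i \<le> n" using i(1) by simp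
    ultimately have "1 \<le> y \<and> y \<le> n - card J"
      using gap[of n i] below[OF i(1)] i(2) by linarith
    then show "y \<in> {1..n - card J}" by simp
  qed
  moreover have "card (f ` ({1..n} - J)) = n - card J"
    using J strict_mono_on_imp_inj_on[OF mono]
    by (simp add: card_image card_Diff_subset finite_subset)
  ultimately show "f ` ({1..n} - J) = {1..n - card J}"
    by (intro card_subset_eq) auto
qed

lemma outcome_count_remove_cars:
  assumes J: "J \<subseteq> {1..n}" and I: "I \<subseteq> {1..n}" and s: "1 \<le> s" "s \<le> Suc (n - card J)"
  shows "outcome_count s (n - card J) (remove_cars I J) = card (arrangements s ({1..n} - J) I)"
proof -
  define f where "f = (\<lambda>i. i - card (J \<inter> {1..i}))"
  let ?C = "{1..n} - J"
  have img: "f ` ?C = {1..n - card J}"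
    using image_closing_gaps[OF J] by (simp add: f_def)
  have "I \<inter> ?C = I - J" using I by auto
  then have rem: "remove_cars I J = f ` (I \<inter> ?C)"
    by (auto simp: remove_cars_def f_def)
  then have "remove_cars I J \<subseteq> {1..n - card J}"
    using img by auto
  then have "outcome_count s (n - card J) (remove_cars I J)
               = card (arrangements s (f ` ?C) (f ` (I \<inter> ?C)))"
    using outcome_count_eq_card_arrangements[OF s] img rem by simp
  also have "\<dots> = card (arrangements s ?C I)"
    using card_arrangements_relabel strict_mono_on_closing_gaps[OF J] by (simp add: f_def)
  finally show ?thesis .
qed

section \<open>Splitting off the cars in front of the unavailable spot\<close>

lemma arrangement_Cons:
  "arrangement s I (x # w) \<longleftrightarrow> (x \<in> I \<or> s = 1) \<and>
     (\<forall>p<length w. w ! p \<notin> I \<longrightarrow> Suc (Suc p) = s \<or> (x # w) ! p < w ! p)"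
  unfolding arrangement_def by (auto simp: All_less_Suc2)

text \<open>
  After the gap nothing depends on what stands before it. On both streets the remainder is an
  arrangement whose first letter is free, as if the gap were spot 1.
\<close>

lemma arrangement_2_Cons: "arrangement 2 I (t # w) \<longleftrightarrow> t \<in> I \<and> arrangement 1 I w"
proof -
  have "Suc (Suc p) = 2 \<or> (t # w) ! p < w ! p \<longleftrightarrow> Suc p = 1 \<or> 0 < p \<and> w ! (p - 1) < w ! p" for p
    by (cases p) auto
  then have "arrangement 1 I w \<longleftrightarrow>
      (\<forall>p<length w. w ! p \<notin> I \<longrightarrow> Suc (Suc p) = 2 \<or> (t # w) ! p < w ! p)"
    by (simp only: arrangement_def)
  then show ?thesis
    unfolding arrangement_Cons by simp
qed

lemma arrangement_3_Cons_Cons: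
  "arrangement 3 I (i # t # w) \<longleftrightarrow> i \<in> I \<and> (t \<in> I \<or> i < t) \<and> arrangement 1 I w"
proof -
  have "Suc (Suc (Suc p)) = 3 \<or> (t # w) ! p < w ! p \<longleftrightarrow> Suc p = 1 \<or> 0 < p \<and> w ! (p - 1) < w ! p"
    for p
    by (cases p) auto
  then have "arrangement 1 I w \<longleftrightarrow>
      (\<forall>p<length w. w ! p \<notin> I \<longrightarrow> Suc (Suc (Suc p)) = 3 \<or> (t # w) ! p < w ! p)"
    by (simp only: arrangement_def)
  moreover have "arrangement 3 I (i # t # w) \<longleftrightarrow> i \<in> I \<and> (t \<in> I \<or> i < t) \<and>
      (\<forall>p<length w. w ! p \<notin> I \<longrightarrow> Suc (Suc (Suc p)) = 3 \<or> (t # w) ! p < w ! p)"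
    unfolding arrangement_Cons list.size add_Suc_right add_0_right All_less_Suc2
    by (simp add: disj_imp)
  ultimately show ?thesis
    by simp
qed

lemma finite_arrangements: "finite C \<Longrightarrow> finite (arrangements s C I)"
  by (rule finite_subset[OF _ finite_subset_distinct[of C]]) (auto simp: arrangements_def)

lemma card_lists_by_head:
  assumes "finite A" "finite H" "\<And>v. v \<in> A \<Longrightarrow> \<exists>h\<in>H. \<exists>w. v = h # w"
  shows "card A = (\<Sum>h\<in>H. card {w. h # w \<in> A})"
proof -
  have "A = (\<Union>h\<in>H. (#) h ` {w. h # w \<in> A})"
    using assms(3) by blast
  moreover have fin: "finite {w. h # w \<in> A}" for h
    using assms(1) by (rule finite_vimageI[of A "(#) h", unfolded vimage_def]) auto
  ultimately have "card A = (\<Sum>h\<in>H. card ((#) h ` {w. h # w \<in> A}))"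
    using assms(2) by (subst \<open>A = _\<close>, intro card_UN_disjoint) auto
  also have "\<dots> = (\<Sum>h\<in>H. card {w. h # w \<in> A})"
    by (intro sum.cong card_image) auto
  finally show ?thesis .
qed

text \<open>
  The words are sorted by their first car \<open>i\<close>, which is lucky. Those whose second car \<open>t\<close> is lucky
  match the arrangements for gap 2 of the other cars; the rest are sorted again, by \<open>t\<close>.
\<close>

lemma card_arrangements_3:
  assumes C: "finite C" "2 \<le> card C" and I: "I \<subseteq> C"
  shows "card (arrangements 3 C I) =
    (\<Sum>i\<in>I. card (arrangements 2 (C - {i}) I))
    + (\<Sum>i\<in>I. \<Sum>t\<in>{t \<in> C - I. t > i}. card (arrangements 1 (C - {i, t}) I))"
proof -
  have finI: "finite I" using C(1) I by (rule finite_subset[rotated])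
  \<comment> \<open>both spots in front of the gap are occupied since there are at least two cars\<close>
  have two: "\<exists>i t w. v = i # t # w" if "v \<in> arrangements 3 C I" for v
  proof -
    have "2 \<le> length v"
      using that C(2) by (auto simp: arrangements_def distinct_card)
    then show ?thesis
      by (cases v; cases "tl v") auto
  qed
  have tails: "card {w. i # w \<in> arrangements 3 C I} =
      card (arrangements 2 (C - {i}) I)
      + (\<Sum>t\<in>{t \<in> C - I. t > i}. card (arrangements 1 (C - {i, t}) I))" if i: "i \<in> I" for i
  proof -
    define A where "A = {w. i # w \<in> arrangements 3 C I}"
    \<comment> \<open>the tails whose first letter, the second car on the street, is unlucky\<close>
    define U where "U = {w \<in> A. hd w \<notin> I}"
    have A2: "arrangements 2 (C - {i}) I = {w \<in> A. hd w \<in> I}"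
    proof (intro set_eqI iffI)
      fix v assume v: "v \<in> arrangements 2 (C - {i}) I"
      have "v \<noteq> []"
      proof
        assume "v = []"
        then have "C \<subseteq> {i}" using v by (auto simp: arrangements_def)
        then have "card C \<le> card {i}" by (intro card_mono) auto
        with C(2) show False by simp
      qed
      then obtain t w where "v = t # w" by (cases v) auto
      with v i I show "v \<in> {w \<in> A. hd w \<in> I}"
        by (auto simp: A_def arrangements_def arrangement_2_Cons arrangement_3_Cons_Cons)
    next
      fix v assume v: "v \<in> {w \<in> A. hd w \<in> I}"
      then obtain t w where "v = t # w" using two[of "i # v"] by (auto simp: A_def)
      with v show "v \<in> arrangements 2 (C - {i}) I"
        by (auto simp: A_def arrangements_def arrangement_2_Cons arrangement_3_Cons_Cons)
    qed
    have finA: "finite A"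
      unfolding A_def using finite_arrangements[OF C(1)]
      by (rule finite_vimageI[of _ "(#) i", unfolded vimage_def]) auto
    have "card A = card {w \<in> A. hd w \<in> I} + card U"
      unfolding U_def using finA by (subst card_Un_disjoint[symmetric]) (auto intro!: arg_cong[of _ _ card])
    moreover have "card U = (\<Sum>t\<in>{t \<in> C - I. t > i}. card {w. t # w \<in> U})"
    proof (rule card_lists_by_head)
      fix v assume v: "v \<in> U"
      then obtain t w where "v = t # w" using two[of "i # v"] by (auto simp: A_def U_def)
      with v show "\<exists>t\<in>{t \<in> C - I. t > i}. \<exists>w. v = t # w"
        by (auto simp: U_def A_def arrangements_def arrangement_2_Cons arrangement_3_Cons_Cons)
    qed (use finA C(1) in \<open>auto simp: U_def\<close>)
    moreover have "{w. t # w \<in> U} = arrangements 1 (C - {i, t}) I"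
      if "t \<in> {t \<in> C - I. t > i}" for t
      using that i I by (auto simp: U_def A_def arrangements_def arrangement_2_Cons arrangement_3_Cons_Cons)
    ultimately show ?thesis
      by (simp add: A2 flip: A_def)
  qed
  have "card (arrangements 3 C I) = (\<Sum>i\<in>I. card {w. i # w \<in> arrangements 3 C I})"
  proof (rule card_lists_by_head)
    fix v assume v: "v \<in> arrangements 3 C I"
    then obtain i t w where "v = i # t # w" using two by blast
    with v show "\<exists>i\<in>I. \<exists>w. v = i # w"
      by (auto simp: arrangements_def arrangement_2_Cons arrangement_3_Cons_Cons)
  qed (use finite_arrangements C(1) finI in auto)
  then show ?thesis
    by (simp add: tails sum.distrib)
qed

theorem theorem3p17:
  fixes n :: nat and I :: "nat set"
  assumes "n \<ge> 2" and "I \<subseteq> {1..n}"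
  shows "outcome_count 3 n I =
           (\<Sum>i\<in>I. outcome_count 2 (n - 1) (remove_cars I {i}))
         + (\<Sum>i\<in>I. \<Sum>s\<in>{s \<in> {1..n} - I. s > i}. outcome_count 1 (n - 2) (remove_cars I {i, s}))"
proof -
  have "outcome_count 2 (n - 1) (remove_cars I {i}) = card (arrangements 2 ({1..n} - {i}) I)"
    if "i \<in> I" for i
    using outcome_count_remove_cars[of "{i}" n I 2] that assms by auto
  moreover have "outcome_count 1 (n - 2) (remove_cars I {i, s})
      = card (arrangements 1 ({1..n} - {i, s}) I)"
    if "i \<in> I" "s \<in> {s \<in> {1..n} - I. s > i}" for i s
  proof -
    have "card {i, s} = 2" "{i, s} \<subseteq> {1..n}" using that assms(2) by auto
    then show ?thesis
      using outcome_count_remove_cars[of "{i, s}" n I 1] assms(2) by simp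
  qed
  moreover have "outcome_count 3 n I = card (arrangements 3 {1..n} I)"
    using assms by (intro outcome_count_eq_card_arrangements) auto
  ultimately show ?thesis
    using card_arrangements_3[of "{1..n}" I] assms by simp
qed

end
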